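(* Assume Condition 1 holds. Then for every $N\in\mathbb N$, neither $P_{1,N}$ nor $P_{2,N}$ is variance bounding (i.e. $P_{1,N}\notin\mathcal V$ and $P_{2,N}\notin\mathcal V$).
   Context: Let $\Theta$ and $\mathsf Y$ be metric spaces; $B_{r,z}$ denotes the metric ball of radius $r$ centred at $z$, $B^\complement$ the complement, and $0$ a fixed reference point of $\Theta$. Densities on $\Theta$ are with respect to a common dominating measure $\mathrm d\theta$ (e.g. Lebesgue or counting measure). Fix data $y\in\mathsf Y$, a tolerance $\epsilon>0$, a prior density $p:\Theta\to\mathbb R_+$ (possibly improper), and for each $\theta\in\Theta$ a probability density $f_\theta$ on $\mathsf Y$. Define $h(\theta)=f_\theta(B_{\epsilon,y})\in[0,1]$ and $w(x)=I(y\in B_{\epsilon,x})$ for $x\in\mathsf Y$. Assume $H=\int_\Theta p(\theta)h(\theta)\,\mathrm d\theta\in(0,\infty)$ and let $\pi(\theta)=p(\theta)h(\theta)/H$. Let $q(\theta,\cdot)$ be a proposal density for each $\theta$, and $c(\theta,\vartheta)=p(\theta)q(\theta,\vartheta)$. $P_{1,N}$ is the Markov kernel on $\Theta\times\mathsf Y^N$ which, from $(\theta,x_{1:N})$, samples $\vartheta\sim q(\theta,\cdot)$ and $z_{1:N}\sim f_\vartheta^{\otimes N}$ and moves to $(\vartheta,z_{1:N})$ with probability $1\wedge \frac{c(\vartheta,\theta)\sum_{j=1}^N w(z_j)}{c(\theta,\vartheta)\sum_{j=1}^N w(x_j)}$, otherwise stays at $(\theta,x_{1:N})$; it is reversible with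 respect to $\bar\pi(\theta,x_{1:N})\propto p(\theta)\prod_{j=1}^N f_\theta(x_j)\frac1N\sum_{j=1}^N w(x_j)$, whose $\theta$-marginal is $\pi$. $P_{2,N}$ is the Markov kernel on $\Theta$ given by $P(\theta,\mathrm d\vartheta)=q(\theta,\mathrm d\vartheta)\alpha(\theta,\vartheta)+\{1-\int_\Theta q(\theta,\mathrm d\theta')\alpha(\theta,\theta')\}\delta_\theta(\mathrm d\vartheta)$ with $$\alpha_{2,N}(\theta,\vartheta)=\int_{\mathsf Y^N}\int_{\mathsf Y^{N-1}}\Big[1\wedge\frac{c(\vartheta,\theta)\sum_{j=1}^N w(z_j)}{c(\theta,\vartheta)\{1+\sum_{j=1}^{N-1}w(x_j)\}}\Big]f_\theta^{\otimes N-1}(\mathrm dx_{1:N-1})f_\vartheta^{\otimes N}(\mathrm dz_{1:N});$$ it is reversible with respect to $\pi$. A kernel reversible w.r.t. a probability $\mu$ is variance bounding if $\sup\sigma_0(P)<1$, where $\sigma_0(P)$ is the spectrum of $P$ on $L^2_0(\mu)$ (mean-zero square-integrable functions); $\mathcal V$ denotes the class of such reversible kernels. $\mathcal Q$ is the set of proposals $q$ such that for all $\delta>0$ there exists $r\in(0,\infty)$ with $q(\theta,B^\complement_{r,\theta})<\delta$ for all $\theta\in\Theta$. Condition 1: $q\in\mathcal Q$; $\pi(B^\complement_{r,0})>0$ for all $r>0$; and $\lim_{v\to\infty}\sup_{\theta\in B^\complement_{v,0}}h(\theta)=0$. *)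

theory Defs
  imports "HOL-Probability.Probability"
begin

text \<open>Square-integrable, mean-zero functions (represented by measurable functions;
  equality is always understood almost everywhere).\<close>
definition L2_0 :: "'s measure \<Rightarrow> ('s \<Rightarrow> real) set" where
  "L2_0 M = {g. g \<in> borel_measurable M \<and> integrable M (\<lambda>x. (g x)^2) \<and> integral\<^sup>L M g = 0}"

text \<open>Spectrum of an operator T on L^2_0(M): l is in the resolvent set iff T - l I is a
  bijection of L^2_0(M) (modulo a.e. equality); by the bounded inverse theorem this is the
  usual spectrum for a bounded operator.\<close>
definition spectrum0 :: "'s measure \<Rightarrow> (('s \<Rightarrow> real) \<Rightarrow> ('s \<Rightarrow> real)) \<Rightarrow> real set" where
  "spectrum0 M T = {l. \<not> ((\<forall>g\<in>L2_0 M. \<exists>u\<in>L2_0 M. AE x in M. T u x - l * u x = g x)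
                         \<and> (\<forall>u\<in>L2_0 M. (AE x in M. T u x = l * u x) \<longrightarrow> (AE x in M. u x = 0)))}"

definition variance_bounding :: "'s measure \<Rightarrow> (('s \<Rightarrow> real) \<Rightarrow> ('s \<Rightarrow> real)) \<Rightarrow> bool" where
  "variance_bounding M T \<longleftrightarrow> Sup (ereal ` spectrum0 M T) < 1"

definition lik :: "'b measure \<Rightarrow> ('a \<Rightarrow> 'b \<Rightarrow> real) \<Rightarrow> 'a \<Rightarrow> 'b measure" where
  "lik nu f \<theta> = density nu (\<lambda>x. ennreal (f \<theta> x))"

definition hfun :: "'b measure \<Rightarrow> ('a \<Rightarrow> 'b \<Rightarrow> real) \<Rightarrow> 'b::metric_space \<Rightarrow> real \<Rightarrow> 'a \<Rightarrow> real" where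
  "hfun nu f y eps \<theta> = measure (lik nu f \<theta>) (ball y eps)"

definition wfun :: "'b::metric_space \<Rightarrow> real \<Rightarrow> 'b \<Rightarrow> real" where
  "wfun y eps x = (if y \<in> ball x eps then 1 else 0)"

definition Hconst :: "'a measure \<Rightarrow> ('a \<Rightarrow> real) \<Rightarrow> 'b measure \<Rightarrow> ('a \<Rightarrow> 'b \<Rightarrow> real)
    \<Rightarrow> 'b::metric_space \<Rightarrow> real \<Rightarrow> real" where
  "Hconst M p nu f y eps = (\<integral>\<theta>. p \<theta> * hfun nu f y eps \<theta> \<partial>M)"

definition post :: "'a measure \<Rightarrow> ('a \<Rightarrow> real) \<Rightarrow> 'b measure \<Rightarrow> ('a \<Rightarrow> 'b \<Rightarrow> real)
    \<Rightarrow> 'b::metric_space \<Rightarrow> real \<Rightarrow> 'a measure" where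
  "post M p nu f y eps =
     density M (\<lambda>\<theta>. ennreal (p \<theta> * hfun nu f y eps \<theta> / Hconst M p nu f y eps))"

definition ext_post :: "nat \<Rightarrow> 'a measure \<Rightarrow> ('a \<Rightarrow> real) \<Rightarrow> 'b measure \<Rightarrow> ('a \<Rightarrow> 'b \<Rightarrow> real)
    \<Rightarrow> 'b::metric_space \<Rightarrow> real \<Rightarrow> ('a \<times> (nat \<Rightarrow> 'b)) measure" where
  "ext_post N M p nu f y eps =
     density (M \<Otimes>\<^sub>M PiM {..<N} (\<lambda>_. nu))
       (\<lambda>(\<theta>, x). ennreal (p \<theta> * (\<Prod>j<N. f \<theta> (x j)) * (\<Sum>j<N. wfun y eps (x j))
                            / (real N * Hconst M p nu f y eps)))"

definition alpha1 :: "nat \<Rightarrow> ('a \<Rightarrow> real) \<Rightarrow> ('a \<Rightarrow> 'a \<Rightarrow> real) \<Rightarrow> 'b::metric_space \<Rightarrow> real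
    \<Rightarrow> 'a \<Rightarrow> (nat \<Rightarrow> 'b) \<Rightarrow> 'a \<Rightarrow> (nat \<Rightarrow> 'b) \<Rightarrow> real" where
  "alpha1 N p q y eps \<theta> x t z =
     min 1 ((p t * q t \<theta> * (\<Sum>j<N. wfun y eps (z j)))
            / (p \<theta> * q \<theta> t * (\<Sum>j<N. wfun y eps (x j))))"

definition P1op :: "nat \<Rightarrow> 'a measure \<Rightarrow> ('a \<Rightarrow> real) \<Rightarrow> ('a \<Rightarrow> 'a \<Rightarrow> real) \<Rightarrow> 'b measure
    \<Rightarrow> ('a \<Rightarrow> 'b \<Rightarrow> real) \<Rightarrow> 'b::metric_space \<Rightarrow> real
    \<Rightarrow> ('a \<times> (nat \<Rightarrow> 'b) \<Rightarrow> real) \<Rightarrow> ('a \<times> (nat \<Rightarrow> 'b) \<Rightarrow> real)" where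
  "P1op N M p q nu f y eps g = (\<lambda>(\<theta>, x).
     (\<integral>t. q \<theta> t * (\<integral>z. alpha1 N p q y eps \<theta> x t z * g (t, z)
                                  \<partial>PiM {..<N} (\<lambda>_. lik nu f t)) \<partial>M)
     + (1 - (\<integral>t. q \<theta> t * (\<integral>z. alpha1 N p q y eps \<theta> x t z
                                  \<partial>PiM {..<N} (\<lambda>_. lik nu f t)) \<partial>M)) * g (\<theta>, x))"

definition alpha2 :: "nat \<Rightarrow> ('a \<Rightarrow> real) \<Rightarrow> ('a \<Rightarrow> 'a \<Rightarrow> real) \<Rightarrow> 'b measure
    \<Rightarrow> ('a \<Rightarrow> 'b \<Rightarrow> real) \<Rightarrow> 'b::metric_space \<Rightarrow> real \<Rightarrow> 'a \<Rightarrow> 'a \<Rightarrow> real" where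
  "alpha2 N p q nu f y eps \<theta> t =
     (\<integral>z. (\<integral>x. min 1 ((p t * q t \<theta> * (\<Sum>j<N. wfun y eps (z j)))
                        / (p \<theta> * q \<theta> t * (1 + (\<Sum>j<N - 1. wfun y eps (x j)))))
             \<partial>PiM {..<N - 1} (\<lambda>_. lik nu f \<theta>))
        \<partial>PiM {..<N} (\<lambda>_. lik nu f t))"

definition P2op :: "nat \<Rightarrow> 'a measure \<Rightarrow> ('a \<Rightarrow> real) \<Rightarrow> ('a \<Rightarrow> 'a \<Rightarrow> real) \<Rightarrow> 'b measure
    \<Rightarrow> ('a \<Rightarrow> 'b \<Rightarrow> real) \<Rightarrow> 'b::metric_space \<Rightarrow> real \<Rightarrow> ('a \<Rightarrow> real) \<Rightarrow> ('a \<Rightarrow> real)" where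
  "P2op N M p q nu f y eps g = (\<lambda>\<theta>.
     (\<integral>t. q \<theta> t * alpha2 N p q nu f y eps \<theta> t * g t \<partial>M)
     + (1 - (\<integral>t. q \<theta> t * alpha2 N p q nu f y eps \<theta> t \<partial>M)) * g \<theta>)"

end

theory Submission
  imports Defs "HOL-Real_Asymp.Real_Asymp"
begin

text \<open>Far from the reference point both chains almost never move: by tightness of the proposals
  the proposed state also lies far out, where a pseudo-observation hits the ball around the data with
  uniformly small probability. So \<open>T - I\<close> nearly vanishes on the tail sets \<open>A n\<close>: if \<open>e\<close> bounds
  the acceptance probability on \<open>A n\<close>, Cauchy-Schwarz and the (approximate) invariance of the target
  measure give \<open>\<integral>\<^sub>A (T u - u)\<^sup>2 \<le> const * e * \<parallel>u\<parallel>\<^sup>2\<close> with \<open>A = A n\<close>. A square-integrable function whose mass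
  on suitable \<open>A n\<close> decays more slowly than \<open>e\<close> is then not in the range of \<open>T - I\<close>, so 1 belongs to the
  spectrum. This needs neither the spectral theorem nor the bounded inverse theorem.\<close>

section \<open>A criterion for 1 to lie in the spectrum\<close>

lemma one_in_spectrum0:
  fixes T :: "('s \<Rightarrow> real) \<Rightarrow> 's \<Rightarrow> real"
  assumes M: "prob_space M"
    and A: "\<And>n. A n \<in> sets M" "decseq A" "(\<Inter>n. A n) = {}" "\<And>n. emeasure M (A n) > 0"
    and bound: "\<And>e. e > 0 \<Longrightarrow> \<exists>n0. \<forall>n\<ge>n0. \<forall>u\<in>L2_0 M.
      (\<integral>\<^sup>+x. ennreal ((T u x - u x)\<^sup>2) * indicator (A n) x \<partial>M)
        \<le> ennreal e * (\<integral>\<^sup>+x. ennreal ((u x)\<^sup>2) \<partial>M)"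
  shows "1 \<in> spectrum0 M T"
proof -
  interpret prob_space M by fact
  have "(\<lambda>n. measure M (A n)) \<longlonglongrightarrow> 0"
    using finite_Lim_measure_decseq[of A] A by (auto simp: image_subset_iff)
  note lim = this
  have small: "eventually (\<lambda>k. measure M (A k) \<le> e) sequentially" if "e > 0" for e
    using order_tendstoD(2)[OF lim \<open>e > 0\<close>] by (auto elim: eventually_mono)
  \<comment> \<open>Spreading mass \<open>2^-n\<close> evenly over a set of measure at most
    \<open>4^-n\<close> gives a function of size at least \<open>2^(n/2)\<close> there, so that
    subtracting a mean is harmless for large \<open>n\<close>. The rate \<open>8^-n\<close> is then
    negligible against \<open>2^-n\<close>.\<close>
  have "\<exists>k\<ge>n. measure M (A k) \<le> (1/4)^n \<and> (\<forall>u\<in>L2_0 M.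
      (\<integral>\<^sup>+x. ennreal ((T u x - u x)\<^sup>2) * indicator (A k) x \<partial>M)
        \<le> ennreal ((1/8)^n) * (\<integral>\<^sup>+x. ennreal ((u x)\<^sup>2) \<partial>M))" for n
  proof -
    have "eventually (\<lambda>k. k \<ge> n \<and> measure M (A k) \<le> (1/4)^n \<and> (\<forall>u\<in>L2_0 M.
      (\<integral>\<^sup>+x. ennreal ((T u x - u x)\<^sup>2) * indicator (A k) x \<partial>M)
        \<le> ennreal ((1/8)^n) * (\<integral>\<^sup>+x. ennreal ((u x)\<^sup>2) \<partial>M))) sequentially"
      using bound[of "(1/8)^n"]
      by (intro eventually_conj eventually_ge_at_top small) (auto simp: eventually_sequentially)
    then show ?thesis
      by (auto simp: eventually_sequentially)
  qed
  then have "\<exists>s. \<forall>n. s n \<ge> n \<and> measure M (A (s n)) \<le> (1/4)^n \<and> (\<forall>u\<in>L2_0 M.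
      (\<integral>\<^sup>+x. ennreal ((T u x - u x)\<^sup>2) * indicator (A (s n)) x \<partial>M)
        \<le> ennreal ((1/8)^n) * (\<integral>\<^sup>+x. ennreal ((u x)\<^sup>2) \<partial>M))"
    by (intro choice) blast
  then obtain s where s: "\<And>n. s n \<ge> n" "\<And>n. measure M (A (s n)) \<le> (1/4)^n"
    and sb: "\<And>n u. u \<in> L2_0 M \<Longrightarrow>
      (\<integral>\<^sup>+x. ennreal ((T u x - u x)\<^sup>2) * indicator (A (s n)) x \<partial>M)
        \<le> ennreal ((1/8)^n) * (\<integral>\<^sup>+x. ennreal ((u x)\<^sup>2) \<partial>M)"
    by blast
  define B where "B n = A (s n)" for n
  define b where "b n = measure M (B n)" for n
  have [measurable]: "B n \<in> sets M" for n
    using A by (simp add: B_def)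
  have b0: "b n > 0" for n
    using A(4)[of "s n"] by (simp add: b_def B_def emeasure_eq_measure)
  \<comment> \<open>The square of \<open>G\<close> is integrable, but has mass at least \<open>2^-n\<close> on each \<open>B n\<close>, where the hypothetical
    preimage of the centred \<open>G\<close> leaves only \<open>O(8^-n)\<close>.\<close>
  define c where "c n x = (1/2)^n / b n * indicator (B n) x" for n x
  have c_meas [measurable]: "c n \<in> borel_measurable M" for n
    unfolding c_def by measurable
  have c_nn: "c n x \<ge> 0" for n x
    using b0[of n] by (simp add: c_def)
  have summ: "summable (\<lambda>n. c n x)" for x
  proof -
    \<comment> \<open>Every point leaves the decreasing sets \<open>A\<close>, and
      \<open>s n \<ge> n\<close>, so only finitely many terms are nonzero at
      \<open>x\<close>.\<close>
    obtain m where m: "x \<notin> A m" using A(3) by auto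
    then have "x \<notin> B n" if "n \<ge> m" for n
      using decseqD[OF A(2), of m "s n"] s(1)[of n] that by (auto simp: B_def)
    then show ?thesis
      by (intro summable_finite[of "{..<m}"]) (auto simp: c_def not_less)
  qed
  define G where "G x = sqrt (\<Sum>n. c n x)" for x
  have G_meas [measurable]: "G \<in> borel_measurable M"
    unfolding G_def by measurable
  have Gsq: "(G x)\<^sup>2 = (\<Sum>n. c n x)" for x
    unfolding G_def using suminf_nonneg[OF summ] c_nn by simp
  have G_nn: "G x \<ge> 0" for x
    unfolding G_def using suminf_nonneg[OF summ] c_nn by simp
  have "(\<integral>\<^sup>+x. ennreal ((G x)\<^sup>2) \<partial>M) = (\<integral>\<^sup>+x. (\<Sum>n. ennreal (c n x)) \<partial>M)"
    by (simp add: Gsq suminf_ennreal2[OF c_nn summ])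
  also have "\<dots> = (\<Sum>n. \<integral>\<^sup>+x. ennreal (c n x) \<partial>M)"
    by (rule nn_integral_suminf) simp
  also have "\<dots> = (\<Sum>n. ennreal ((1/2)^n))"
  proof (intro suminf_cong)
    fix n
    have "(\<integral>\<^sup>+x. ennreal (c n x) \<partial>M) = (\<integral>\<^sup>+x. ennreal ((1/2)^n / b n) * indicator (B n) x \<partial>M)"
      by (intro nn_integral_cong) (auto simp: c_def indicator_def)
    also have "\<dots> = ennreal ((1/2)^n / b n) * ennreal (b n)"
      by (simp add: nn_integral_cmult b_def emeasure_eq_measure)
    also have "\<dots> = ennreal ((1/2)^n)"
      using b0[of n] by (simp add: ennreal_mult[symmetric])
    finally show "(\<integral>\<^sup>+x. ennreal (c n x) \<partial>M) = ennreal ((1/2)^n)" .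
  qed
  also have "\<dots> < \<infinity>"
    by (subst suminf_ennreal2) (auto simp: summable_geometric)
  finally have G2_int: "integrable M (\<lambda>x. (G x)\<^sup>2)"
    by (intro integrableI_bounded) auto
  then have G_int: "integrable M G"
    by (rule square_integrable_imp_integrable[rotated]) simp
  define m where "m = integral\<^sup>L M G"
  define g where "g x = G x - m" for x
  have "integrable M (\<lambda>x. (g x)\<^sup>2)"
    unfolding g_def power2_diff using G2_int G_int by simp
  moreover have "g \<in> borel_measurable M"
    unfolding g_def by measurable
  moreover have "integral\<^sup>L M g = 0"
    unfolding g_def using G_int by (simp add: m_def prob_space)
  ultimately have g: "g \<in> L2_0 M"
    by (simp add: L2_0_def)
  show ?thesis
  proof (rule ccontr)
    assume "1 \<notin> spectrum0 M T"
    then obtain u where u: "u \<in> L2_0 M" and eq: "AE x in M. T u x - u x = g x"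
      using g by (auto simp: spectrum0_def)
    define K where "K = (\<integral>x. (u x)\<^sup>2 \<partial>M)"
    have u2: "(\<integral>\<^sup>+x. ennreal ((u x)\<^sup>2) \<partial>M) = ennreal K"
      using u unfolding K_def L2_0_def by (intro nn_integral_eq_integral) auto
    have K: "K \<ge> 0" by (simp add: K_def)
    have ub: "4^n \<le> 4 * K" if n: "2 * \<bar>m\<bar> \<le> sqrt (2^n)" for n
    proof -
      \<comment> \<open>On \<open>B n\<close> the function \<open>G\<close> is at least
        \<open>sqrt (2^n) \<ge> 2 * \<bar>m\<bar>\<close>, so \<open>g = G - m\<close> keeps at
        least half of it; squaring costs the factor 4.\<close>
      have g_lb: "(1/2)^n / (4 * b n) \<le> (g x)\<^sup>2" if x: "x \<in> B n" for x
      proof -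
        have "c n x \<le> (G x)\<^sup>2"
          unfolding Gsq using sum_le_suminf[OF summ[of x], of "{n}"] c_nn by simp
        then have G1: "(1/2)^n / b n \<le> (G x)\<^sup>2" using x by (simp add: c_def)
        have "(2::real)^n = (1/2)^n / (1/4)^n"
          by (simp add: power_divide[symmetric] flip: power_divide)
        also have "\<dots> \<le> (1/2)^n / b n"
          using b0[of n] s(2)[of n] by (intro divide_left_mono) (auto simp: b_def B_def)
        finally have "sqrt (2^n) \<le> G x"
          using G1 G_nn[of x] by (intro real_le_lsqrt) auto
        then have "G x / 2 \<le> g x" using n unfolding g_def by linarith
        then have "(G x / 2)\<^sup>2 \<le> (g x)\<^sup>2"
          using G_nn[of x] by (intro power_mono) auto
        then show ?thesis using G1 by (simp add: power_divide field_simps)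
      qed
      have "ennreal ((1/2)^n / 4) = ennreal ((1/2)^n / (4 * b n)) * emeasure M (B n)"
        using b0[of n] by (simp add: emeasure_eq_measure b_def ennreal_mult[symmetric])
      also have "\<dots> = (\<integral>\<^sup>+x. ennreal ((1/2)^n / (4 * b n)) * indicator (B n) x \<partial>M)"
        by (simp add: nn_integral_cmult)
      also have "\<dots> \<le> (\<integral>\<^sup>+x. ennreal ((T u x - u x)\<^sup>2) * indicator (B n) x \<partial>M)"
        using eq by (intro nn_integral_mono_AE) (auto simp: indicator_def intro!: ennreal_leI g_lb elim!: eventually_mono)
      also have "\<dots> \<le> ennreal ((1/8)^n) * ennreal K"
        using sb[OF u, of n] by (simp add: B_def u2)
      also have "\<dots> = ennreal ((1/8)^n * K)"
        using K by (simp add: ennreal_mult)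
      finally have "(1/2)^n / 4 \<le> (1/8)^n * K"
        using K by (subst (asm) ennreal_le_iff) auto
      then have "8^n * ((1/2)^n) / 4 \<le> 8^n * ((1/8)^n) * K"
        by (simp add: mult.assoc)
      then show ?thesis
        by (simp flip: power_mult_distrib)
    qed
    have "filterlim (\<lambda>n. sqrt (2^n)) at_top sequentially"
      by real_asymp
    then have "eventually (\<lambda>n. 2 * \<bar>m\<bar> \<le> sqrt (2^n)) sequentially"
      by (simp add: filterlim_at_top)
    moreover have "filterlim (\<lambda>n. 4^n :: real) at_top sequentially"
      by real_asymp
    then have "eventually (\<lambda>n. 4 * K + 1 \<le> 4^n) sequentially"
      by (simp add: filterlim_at_top)
    ultimately have "eventually (\<lambda>n::nat. False) sequentially"
      by eventually_elim (use ub in force)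
    then show False by simp
  qed
qed

lemma not_variance_bounding:
  assumes "1 \<in> spectrum0 M T"
  shows "\<not> variance_bounding M T"
  unfolding variance_bounding_def not_less
  using assms by (intro Sup_upper) (auto simp: image_iff one_ereal_def intro!: bexI[of _ 1])

section \<open>The size of \<open>T - I\<close> on a set with small escape mass\<close>

text \<open>Cauchy-Schwarz for the measure with density \<open>k x\<close> bounds the square of
  \<open>\<integral> k |u|\<close> by \<open>e\<close> times \<open>\<integral> k u^2\<close>.
  Integrated against \<open>\<rho>\<close>, with the order of integration exchanged, this returns to
  the norm of \<open>u\<close> by \<open>k_inv\<close>, a sub-invariance of the target up to the
  factor \<open>C\<close>. The diagonal term contributes the summand 1 in \<open>C + 1\<close>, and
  the factor 2 comes from squaring a sum.\<close>

lemma kernel_bound: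
  fixes T :: "('s \<Rightarrow> real) \<Rightarrow> 's \<Rightarrow> real" and k :: "'s \<Rightarrow> 's \<Rightarrow> ennreal"
  assumes L: "sigma_finite_measure L"
    and M: "M = density L \<rho>" and rho [measurable]: "\<rho> \<in> borel_measurable L"
    and k: "(\<lambda>(x, y). k x y) \<in> borel_measurable (L \<Otimes>\<^sub>M L)"
    and A: "A \<in> sets L"
    and k_small: "\<And>x. x \<in> A \<Longrightarrow> (\<integral>\<^sup>+y. k x y \<partial>L) \<le> ennreal e"
    and e: "0 \<le> e" "e \<le> 1" and C: "0 \<le> C"
    and k_inv: "\<And>y. y \<in> space L \<Longrightarrow> (\<integral>\<^sup>+x. \<rho> x * k x y \<partial>L) \<le> ennreal C * \<rho> y"
    and u [measurable]: "u \<in> borel_measurable L"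
    and T: "\<And>x. x \<in> A \<Longrightarrow> ennreal \<bar>T u x - u x\<bar>
      \<le> (\<integral>\<^sup>+y. k x y * ennreal \<bar>u y\<bar> \<partial>L) + (\<integral>\<^sup>+y. k x y \<partial>L) * ennreal \<bar>u x\<bar>"
  shows "(\<integral>\<^sup>+x. ennreal ((T u x - u x)\<^sup>2) * indicator A x \<partial>M)
    \<le> ennreal (2 * e * (C + 1)) * (\<integral>\<^sup>+x. ennreal ((u x)\<^sup>2) \<partial>M)"
proof -
  interpret sigma_finite_measure L by fact
  interpret pair_sigma_finite L L by standard
  note k [measurable]
  define V where "V x = (\<integral>\<^sup>+y. k x y * ennreal ((u y)\<^sup>2) \<partial>L)" for x
  have [measurable]: "V \<in> borel_measurable L"
    unfolding V_def by measurable
  have pw: "ennreal ((T u x - u x)\<^sup>2) \<le> ennreal (2 * e) * (V x + ennreal ((u x)\<^sup>2))"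
    if x: "x \<in> A" for x
  proof -
    define a where "a = (\<integral>\<^sup>+y. k x y \<partial>L)"
    define I where "I = (\<integral>\<^sup>+y. k x y * ennreal \<bar>u y\<bar> \<partial>L)"
    have xs: "x \<in> space L" using x A sets.sets_into_space by blast
    have kx [measurable]: "k x \<in> borel_measurable L"
      using measurable_Pair2[OF k xs] by simp
    have "I\<^sup>2 = (\<integral>\<^sup>+y. ennreal \<bar>u y\<bar> * 1 \<partial>density L (k x))\<^sup>2"
      by (simp add: I_def nn_integral_density)
    also have "\<dots> \<le> (\<integral>\<^sup>+y. (ennreal \<bar>u y\<bar>)\<^sup>2 \<partial>density L (k x)) * (\<integral>\<^sup>+y. 1\<^sup>2 \<partial>density L (k x))"
      by (rule Cauchy_Schwarz_nn_integral) simp_all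
    also have "\<dots> = V x * a"
      by (simp add: nn_integral_density V_def a_def emeasure_density ennreal_power
          cong: nn_integral_cong_simp)
    also have "\<dots> \<le> V x * ennreal e"
      using k_small[OF x] by (intro mult_left_mono) (auto simp: a_def)
    finally have I2: "I\<^sup>2 \<le> V x * ennreal e" .
    have a_e: "a \<le> ennreal e" using k_small[OF x] by (simp add: a_def)
    show ?thesis
    \<comment> \<open>If \<open>V x\<close> is infinite and \<open>e > 0\<close>, the right-hand
      side is infinite. Otherwise \<open>V x * e\<close> is finite, also for \<open>e = 0\<close>,
      where \<open>\<infinity> * 0 = 0\<close>, and real arithmetic applies.\<close>
    proof (cases "V x = \<infinity> \<and> e > 0")
      case True
      then show ?thesis by (simp add: ennreal_mult_top)
    next
      case False
      then have "V x * ennreal e < \<infinity>"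
        using e by (cases "e = 0") (auto simp: ennreal_mult_less_top less_top)
      then have "I\<^sup>2 < \<infinity>" using I2 by auto
      then have "I < \<infinity>" by (auto simp: power2_eq_square less_top[symmetric] ennreal_mult_eq_top_iff)
      then obtain i where i: "I = ennreal i" "0 \<le> i"
        by (cases I) auto
      obtain a' where a': "a = ennreal a'" "0 \<le> a'" "a' \<le> e"
        using a_e e by (cases a) (auto simp: top_unique)
      have "ennreal \<bar>T u x - u x\<bar> \<le> ennreal (i + a' * \<bar>u x\<bar>)"
        using T[OF x] a' i by (simp add: a_def[symmetric] I_def[symmetric] ennreal_mult)
      then have "\<bar>T u x - u x\<bar> \<le> i + a' * \<bar>u x\<bar>"
        using i a' by (subst (asm) ennreal_le_iff) auto
      then have "(T u x - u x)\<^sup>2 \<le> (i + a' * \<bar>u x\<bar>)\<^sup>2"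
        by (metis abs_ge_zero power2_abs power_mono)
      also have "\<dots> \<le> 2 * i\<^sup>2 + 2 * (a'\<^sup>2 * (u x)\<^sup>2)"
        using sum_squares_bound[of i "a' * \<bar>u x\<bar>"] by (simp add: power2_sum power_mult_distrib)
      also have "\<dots> \<le> 2 * i\<^sup>2 + 2 * (e * (u x)\<^sup>2)"
      proof -
        \<comment> \<open>From \<open>a' \<le> e \<le> 1\<close>: the diagonal term is of the same
          order in \<open>e\<close> as the Cauchy-Schwarz term.\<close>
        have "a'\<^sup>2 \<le> e * 1"
          unfolding power2_eq_square using a' e by (intro mult_mono) auto
        then show ?thesis by (auto intro!: mult_right_mono)
      qed
      finally have "ennreal ((T u x - u x)\<^sup>2) \<le> ennreal (2 * i\<^sup>2 + 2 * (e * (u x)\<^sup>2))"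
        by (rule ennreal_leI)
      also have "\<dots> = 2 * I\<^sup>2 + ennreal (2 * e) * ennreal ((u x)\<^sup>2)"
        using i e by (simp add: ennreal_mult ennreal_power mult.assoc)
      also have "\<dots> \<le> 2 * (V x * ennreal e) + ennreal (2 * e) * ennreal ((u x)\<^sup>2)"
        using I2 by (intro add_mono mult_left_mono) auto
      also have "\<dots> = ennreal (2 * e) * (V x + ennreal ((u x)\<^sup>2))"
        using e by (simp add: ennreal_mult distrib_left mult.assoc mult.commute[of "V x"])
      finally show ?thesis .
    qed
  qed
  have "(\<integral>\<^sup>+x. ennreal ((T u x - u x)\<^sup>2) * indicator A x \<partial>M)
      \<le> (\<integral>\<^sup>+x. ennreal (2 * e) * (V x + ennreal ((u x)\<^sup>2)) \<partial>M)"
    by (intro nn_integral_mono) (auto simp: indicator_def intro!: pw)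
  also have "\<dots> = ennreal (2 * e) * ((\<integral>\<^sup>+x. V x \<partial>M) + (\<integral>\<^sup>+x. ennreal ((u x)\<^sup>2) \<partial>M))"
    by (simp add: M nn_integral_cmult nn_integral_add)
  also have "\<dots> \<le> ennreal (2 * e) * (ennreal C * (\<integral>\<^sup>+x. ennreal ((u x)\<^sup>2) \<partial>M)
      + (\<integral>\<^sup>+x. ennreal ((u x)\<^sup>2) \<partial>M))"
  proof (intro mult_left_mono add_right_mono)
    show "(\<integral>\<^sup>+x. V x \<partial>M) \<le> ennreal C * (\<integral>\<^sup>+x. ennreal ((u x)\<^sup>2) \<partial>M)"
    proof -
    have "(\<integral>\<^sup>+x. V x \<partial>M) = (\<integral>\<^sup>+x. (\<integral>\<^sup>+y. \<rho> x * k x y * ennreal ((u y)\<^sup>2) \<partial>L) \<partial>L)"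
      unfolding M by (subst nn_integral_density)
        (auto simp: V_def nn_integral_cmult[symmetric] mult.assoc intro!: nn_integral_cong)
    also have "\<dots> = (\<integral>\<^sup>+y. (\<integral>\<^sup>+x. \<rho> x * k x y * ennreal ((u y)\<^sup>2) \<partial>L) \<partial>L)"
      by (rule Fubini'[symmetric]) measurable
    also have "\<dots> = (\<integral>\<^sup>+y. (\<integral>\<^sup>+x. \<rho> x * k x y \<partial>L) * ennreal ((u y)\<^sup>2) \<partial>L)"
      by (intro nn_integral_cong nn_integral_multc) measurable
    also have "\<dots> \<le> (\<integral>\<^sup>+y. ennreal C * (\<rho> y * ennreal ((u y)\<^sup>2)) \<partial>L)"
      using k_inv by (intro nn_integral_mono) (simp add: mult.assoc[symmetric] mult_right_mono)
    also have "\<dots> = ennreal C * (\<integral>\<^sup>+x. ennreal ((u x)\<^sup>2) \<partial>M)"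
      by (simp add: M nn_integral_density nn_integral_cmult)
    finally show ?thesis .
    qed
  qed simp
  also have "\<dots> = ennreal (2 * e * (C + 1)) * (\<integral>\<^sup>+x. ennreal ((u x)\<^sup>2) \<partial>M)"
    using e C by (simp add: ennreal_mult distrib_right distrib_left mult.assoc)
  finally show ?thesis .
qed

section \<open>Tightness of the proposals far from the reference point\<close>

text \<open>From distance at least \<open>v1 + r\<close>, a proposal within \<open>r\<close> of
  \<open>\<theta>\<close> stays outside the ball of radius \<open>v1\<close>, where
  \<open>h \<le> e / 2\<close>; a longer jump has probability below \<open>e / 2\<close>, and there
  \<open>h \<le> 1\<close>. The radius \<open>r\<close> from tightness is uniform in
  \<open>\<theta>\<close>, hence so is the threshold.\<close>

lemma proposal_tail_small:
  fixes M :: "'a::metric_space measure" and q :: "'a \<Rightarrow> 'a \<Rightarrow> real" and h :: "'a \<Rightarrow> real"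
  assumes M: "sets M = sets borel"
    and q_meas: "\<And>\<theta>. q \<theta> \<in> borel_measurable M"
    and q_prob: "\<And>\<theta>. prob_space (density M (\<lambda>t. ennreal (q \<theta> t)))"
    and q_tight: "\<forall>\<delta>>0. \<exists>r>0. \<forall>\<theta>. measure (density M (\<lambda>t. ennreal (q \<theta> t))) (- ball \<theta> r) < \<delta>"
    and h: "\<And>t. 0 \<le> h t" "\<And>t. h t \<le> 1"
    and h_lim: "((\<lambda>v. SUP t\<in>- ball \<theta>0 v. h t) \<longlongrightarrow> 0) at_top"
    and e: "e > 0"
  shows "\<exists>v0. \<forall>v\<ge>v0. \<forall>\<theta>\<in>- ball \<theta>0 v. (\<integral>\<^sup>+t. ennreal (q \<theta> t) * ennreal (h t) \<partial>M) \<le> ennreal e"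
proof -
  note q_meas [measurable]
  have space: "space M = UNIV"
    using sets_eq_imp_space_eq[OF M] by simp
  have open_sets [measurable]: "open U \<Longrightarrow> U \<in> sets M" for U
    using M by auto
  obtain r where r: "r > 0"
    "\<And>\<theta>. measure (density M (\<lambda>t. ennreal (q \<theta> t))) (- ball \<theta> r) < e / 2"
    using q_tight e by (metis half_gt_zero)
  have "eventually (\<lambda>v. (SUP t\<in>- ball \<theta>0 v. h t) < e / 2) at_top"
    using order_tendstoD(2)[OF h_lim, of "e / 2"] e by simp
  then obtain v1 where v1: "\<And>v. v \<ge> v1 \<Longrightarrow> (SUP t\<in>- ball \<theta>0 v. h t) < e / 2"
    by (auto simp: eventually_at_top_linorder)
  have h_small: "h t \<le> e / 2" if "t \<notin> ball \<theta>0 v1" for t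
  proof -
    \<comment> \<open>The bound \<open>h \<le> 1\<close> is what makes the real-valued
      \<open>SUP\<close> an upper bound of its members.\<close>
    have "h t \<le> (SUP t\<in>- ball \<theta>0 v1. h t)"
      using that h by (intro cSUP_upper) (auto intro!: bdd_aboveI[of _ 1])
    then show ?thesis using v1[of v1] by simp
  qed
  show ?thesis
  proof (intro exI[of _ "v1 + r"] allI impI ballI)
    fix v \<theta> assume v: "v1 + r \<le> v" and \<theta>: "\<theta> \<in> - ball \<theta>0 v"
    let ?Q = "density M (\<lambda>t. ennreal (q \<theta> t))"
    interpret Q: prob_space ?Q by (rule q_prob)
    have mB: "- ball \<theta> r \<in> sets M" using open_sets[OF open_ball, of \<theta> r] sets.compl_sets space
      by (metis Compl_eq_Diff_UNIV)
    have "ennreal (q \<theta> t) * ennreal (h t) \<le>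
        ennreal (q \<theta> t) * (indicator (- ball \<theta> r) t + ennreal (e / 2))" for t
    proof (cases "t \<in> ball \<theta> r")
      case True
      have "dist \<theta>0 \<theta> \<le> dist \<theta>0 t + dist \<theta> t"
        by (metis dist_commute dist_triangle)
      with True \<theta> v have "h t \<le> e / 2"
        by (intro h_small) auto
      then show ?thesis using True by (auto intro!: mult_left_mono ennreal_leI)
    next
      case False
      then show ?thesis using h(2)[of t] by (intro mult_left_mono) (auto intro: add_increasing2)
    qed
    then have "(\<integral>\<^sup>+t. ennreal (q \<theta> t) * ennreal (h t) \<partial>M)
        \<le> (\<integral>\<^sup>+t. ennreal (q \<theta> t) * (indicator (- ball \<theta> r) t + ennreal (e / 2)) \<partial>M)"
      by (intro nn_integral_mono)
    also have "\<dots> = (\<integral>\<^sup>+t. indicator (- ball \<theta> r) t + ennreal (e / 2) \<partial>?Q)"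
      using mB by (subst nn_integral_density) auto
    also have "\<dots> = emeasure ?Q (- ball \<theta> r) + ennreal (e / 2)"
      using mB Q.emeasure_space_1 by (subst nn_integral_add) auto
    also have "\<dots> \<le> ennreal (e / 2) + ennreal (e / 2)"
      using r(2)[of \<theta>] by (intro add_right_mono) (auto simp: Q.emeasure_eq_measure intro!: ennreal_leI)
    also have "\<dots> = ennreal e"
      using e by (simp flip: ennreal_plus)
    finally show "(\<integral>\<^sup>+t. ennreal (q \<theta> t) * ennreal (h t) \<partial>M) \<le> ennreal e" .
  qed
qed

section \<open>Products of densities\<close>

text \<open>Both measures agree on finite rectangles, where the integrand factorises. This turns
  integrals over pseudo-observations drawn from a \<open>t\<close>-dependent law into integrals over
  one fixed base measure, with the likelihood as a factor.\<close>

lemma PiM_density: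
  fixes nu :: "'i \<Rightarrow> 'b measure" and g :: "'i \<Rightarrow> 'b \<Rightarrow> ennreal"
  assumes nu: "\<And>i. sigma_finite_measure (nu i)"
    and g [measurable]: "\<And>i. g i \<in> borel_measurable (nu i)"
    and g_sf: "\<And>i. sigma_finite_measure (density (nu i) (g i))"
    and I: "finite I"
  shows "PiM I (\<lambda>i. density (nu i) (g i)) = density (PiM I nu) (\<lambda>x. \<Prod>i\<in>I. g i (x i))"
proof -
  interpret N: product_sigma_finite nu by (intro product_sigma_finite.intro nu)
  interpret D: product_sigma_finite "\<lambda>i. density (nu i) (g i)" by (intro product_sigma_finite.intro g_sf)
  show ?thesis
  proof (rule D.PiM_eqI[OF I, symmetric])
    show "sets (density (PiM I nu) (\<lambda>x. \<Prod>i\<in>I. g i (x i))) = sets (PiM I (\<lambda>i. density (nu i) (g i)))"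
      by (simp cong: sets_PiM_cong)
    fix A assume "\<And>i. i \<in> I \<Longrightarrow> A i \<in> sets (density (nu i) (g i))"
    then have A [measurable]: "\<And>i. i \<in> I \<Longrightarrow> A i \<in> sets (nu i)" by simp
    have "emeasure (density (PiM I nu) (\<lambda>x. \<Prod>i\<in>I. g i (x i))) (Pi\<^sub>E I A)
        = (\<integral>\<^sup>+x. (\<Prod>i\<in>I. g i (x i)) * indicator (Pi\<^sub>E I A) x \<partial>PiM I nu)"
      using A I by (subst emeasure_density) (auto intro!: sets_PiM_I_finite)
    also have "\<dots> = (\<integral>\<^sup>+x. (\<Prod>i\<in>I. g i (x i) * indicator (A i) (x i)) \<partial>PiM I nu)"
    proof (rule nn_integral_cong)
      fix x assume "x \<in> space (PiM I nu)"
      then have "indicator (Pi\<^sub>E I A) x = (\<Prod>i\<in>I. indicator (A i) (x i) :: ennreal)"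
        using I by (auto simp: indicator_def PiE_iff space_PiM prod_zero_iff)
      then show "(\<Prod>i\<in>I. g i (x i)) * indicator (Pi\<^sub>E I A) x = (\<Prod>i\<in>I. g i (x i) * indicator (A i) (x i))"
        by (simp add: prod.distrib)
    qed
    also have "\<dots> = (\<Prod>i\<in>I. emeasure (density (nu i) (g i)) (A i))"
      using A I by (subst N.product_nn_integral_prod) (auto intro!: prod.cong simp: emeasure_density)
    finally show "emeasure (density (PiM I nu) (\<lambda>x. \<Prod>i\<in>I. g i (x i))) (Pi\<^sub>E I A)
        = (\<Prod>i\<in>I. emeasure (density (nu i) (g i)) (A i))" .
  qed
qed

section \<open>The criterion for operators dominated by a kernel\<close>

text \<open>The mass of \<open>k\<close> tends to 0 uniformly along the sets \<open>A n\<close>, so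
  \<open>kernel_bound\<close> supplies the hypothesis of \<open>one_in_spectrum0\<close>. The kernel
  \<open>k\<close> only has to dominate the moves of \<open>T\<close>, which is why \<open>C\<close>
  may exceed 1.\<close>

lemma not_variance_bounding_kernel:
  fixes T :: "('s \<Rightarrow> real) \<Rightarrow> 's \<Rightarrow> real" and k :: "'s \<Rightarrow> 's \<Rightarrow> ennreal"
  assumes L: "sigma_finite_measure L"
    and rho: "\<rho> \<in> borel_measurable L" and prob: "prob_space (density L \<rho>)"
    and k: "(\<lambda>(x, y). k x y) \<in> borel_measurable (L \<Otimes>\<^sub>M L)"
    and A: "\<And>n. A n \<in> sets L" "decseq A" "(\<Inter>n. A n) = {}"
      "\<And>n. emeasure (density L \<rho>) (A n) > 0"
    and k_small: "\<And>e. e > 0 \<Longrightarrow> \<exists>n0. \<forall>n\<ge>n0. \<forall>x\<in>A n. (\<integral>\<^sup>+y. k x y \<partial>L) \<le> ennreal e"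
    and C: "0 \<le> C"
    and k_inv: "\<And>y. y \<in> space L \<Longrightarrow> (\<integral>\<^sup>+x. \<rho> x * k x y \<partial>L) \<le> ennreal C * \<rho> y"
    and T: "\<And>u x. u \<in> borel_measurable L \<Longrightarrow> x \<in> space L \<Longrightarrow> ennreal \<bar>T u x - u x\<bar>
      \<le> (\<integral>\<^sup>+y. k x y * ennreal \<bar>u y\<bar> \<partial>L) + (\<integral>\<^sup>+y. k x y \<partial>L) * ennreal \<bar>u x\<bar>"
  shows "\<not> variance_bounding (density L \<rho>) T"
proof (intro not_variance_bounding one_in_spectrum0[where A = A] prob A)
  show "A n \<in> sets (density L \<rho>)" for n using A by simp
  fix e :: real assume e: "e > 0"
  \<comment> \<open>The cap at 1 meets the condition \<open>e \<le> 1\<close> of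
    \<open>kernel_bound\<close>; the other term absorbs its constant
    \<open>2 * (C + 1)\<close>.\<close>
  define e' where "e' = min 1 (e / (2 * (C + 1)))"
  have e': "0 < e'" "e' \<le> 1" using e C by (auto simp: e'_def)
  have "2 * e' * (C + 1) \<le> 2 * (e / (2 * (C + 1))) * (C + 1)"
    using C by (intro mult_right_mono mult_left_mono) (auto simp: e'_def)
  also have "\<dots> = e" using C by (simp add: field_simps)
  finally have e'_e: "2 * e' * (C + 1) \<le> e" .
  obtain n0 where n0: "\<And>n x. n \<ge> n0 \<Longrightarrow> x \<in> A n \<Longrightarrow> (\<integral>\<^sup>+y. k x y \<partial>L) \<le> ennreal e'"
    using k_small[OF e'(1)] by blast
  show "\<exists>n0. \<forall>n\<ge>n0. \<forall>u\<in>L2_0 (density L \<rho>).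
      (\<integral>\<^sup>+x. ennreal ((T u x - u x)\<^sup>2) * indicator (A n) x \<partial>density L \<rho>)
        \<le> ennreal e * (\<integral>\<^sup>+x. ennreal ((u x)\<^sup>2) \<partial>density L \<rho>)"
  proof (intro exI[of _ n0] allI impI ballI)
    fix n u assume n: "n \<ge> n0" and u: "u \<in> L2_0 (density L \<rho>)"
    have u_meas: "u \<in> borel_measurable L" using u by (simp add: L2_0_def)
    have "(\<integral>\<^sup>+x. ennreal ((T u x - u x)\<^sup>2) * indicator (A n) x \<partial>density L \<rho>)
        \<le> ennreal (2 * e' * (C + 1)) * (\<integral>\<^sup>+x. ennreal ((u x)\<^sup>2) \<partial>density L \<rho>)"
    proof (rule kernel_bound[OF L refl rho k A(1) _ _ e'(2) C k_inv u_meas])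
      show "x \<in> A n \<Longrightarrow> (\<integral>\<^sup>+y. k x y \<partial>L) \<le> ennreal e'" for x using n n0 by blast
      show "0 \<le> e'" using e' by simp
      show "ennreal \<bar>T u x - u x\<bar>
          \<le> (\<integral>\<^sup>+y. k x y * ennreal \<bar>u y\<bar> \<partial>L) + (\<integral>\<^sup>+y. k x y \<partial>L) * ennreal \<bar>u x\<bar>"
        if "x \<in> A n" for x
        using T[OF u_meas] that A(1)[of n] sets.sets_into_space by blast
    qed
    also have "\<dots> \<le> ennreal e * (\<integral>\<^sup>+x. ennreal ((u x)\<^sup>2) \<partial>density L \<rho>)"
      using e'_e by (intro mult_right_mono ennreal_leI) auto
    finally show "(\<integral>\<^sup>+x. ennreal ((T u x - u x)\<^sup>2) * indicator (A n) x \<partial>density L \<rho>)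
        \<le> ennreal e * (\<integral>\<^sup>+x. ennreal ((u x)\<^sup>2) \<partial>density L \<rho>)" .
  qed
qed

section \<open>Elementary estimates for integrals and acceptance ratios\<close>

text \<open>Without integrability the Bochner integral is 0 by convention, so the bound holds for
  every real function. The operators can thus be estimated without checking integrability of their
  integrands.\<close>

lemma abs_integral_le_nn_integral: "ennreal \<bar>\<integral>x. f x \<partial>M\<bar> \<le> (\<integral>\<^sup>+x. ennreal \<bar>f x\<bar> \<partial>M)"
  for f :: "_ \<Rightarrow> real"
  using integral_norm_bound_ennreal[of M f] by (cases "integrable M f") (auto simp: not_integrable_integral_eq)

text \<open>Here \<open>I\<close> is the contribution of accepted moves, \<open>a\<close> the total
  acceptance probability and \<open>u\<close> the value at the current state: the rejection term
  cancels against \<open>u\<close> up to \<open>a * u\<close>. The bounds \<open>B\<close> and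
  \<open>b\<close> may be infinite.\<close>

lemma abs_perturbation_le:
  assumes "ennreal \<bar>I\<bar> \<le> B" "ennreal \<bar>a\<bar> \<le> b"
  shows "ennreal \<bar>I + (1 - a) * u - u\<bar> \<le> B + b * ennreal \<bar>u\<bar>"
proof -
  have "\<bar>I + (1 - a) * u - u\<bar> = \<bar>I - a * u\<bar>"
    by (simp add: algebra_simps)
  also have "\<dots> \<le> \<bar>I\<bar> + \<bar>a\<bar> * \<bar>u\<bar>"
    by (metis abs_mult abs_triangle_ineq4)
  finally have "ennreal \<bar>I + (1 - a) * u - u\<bar> \<le> ennreal \<bar>I\<bar> + ennreal \<bar>a\<bar> * ennreal \<bar>u\<bar>"
    by (simp add: ennreal_leI flip: ennreal_mult ennreal_plus)
  also have "\<dots> \<le> B + b * ennreal \<bar>u\<bar>"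
    using assms by (intro add_mono mult_right_mono) auto
  finally show ?thesis .
qed

lemma min_ratio_le:
  fixes a b d :: real
  assumes "0 \<le> a" "0 \<le> b" "d = 0 \<or> 1 \<le> d"
  shows "min 1 (a * real m / (b * d)) \<le> real m * min 1 (a / b)"
proof (cases "m = 0 \<or> d = 0")
  case True
  then show ?thesis using assms by auto
next
  case False
  then have m: "1 \<le> real m" and d: "1 \<le> d" using assms by auto
  have "a * real m / (b * d) = a / b * real m / d" by simp
  also have "\<dots> \<le> a / b * real m / 1"
    using assms d by (intro divide_left_mono mult_nonneg_nonneg divide_nonneg_nonneg) auto
  finally have "a * real m / (b * d) \<le> real m * (a / b)" by (simp add: mult.commute)
  then show ?thesis using m by (auto simp: min_def intro: order_trans)
qed

section \<open>The model, the target densities and the dominating kernels\<close>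

locale abc_posterior =
  fixes M :: "'a::metric_space measure" and nu :: "'b::metric_space measure"
    and p :: "'a \<Rightarrow> real" and q :: "'a \<Rightarrow> 'a \<Rightarrow> real" and f :: "'a \<Rightarrow> 'b \<Rightarrow> real"
    and y :: 'b and eps :: real and \<theta>0 :: 'a and N :: nat
  assumes M_borel: "sets M = sets borel" and M_sf: "sigma_finite_measure M"
    and nu_borel: "sets nu = sets borel" and nu_sf: "sigma_finite_measure nu"
    and p_meas: "p \<in> borel_measurable M" and p_nonneg: "p \<theta> \<ge> 0"
    and f_meas: "(\<lambda>(\<theta>, x). f \<theta> x) \<in> borel_measurable (M \<Otimes>\<^sub>M nu)"
    and f_nonneg: "f \<theta> x \<ge> 0"
    and f_prob: "prob_space (lik nu f \<theta>)"
    and q_meas: "(\<lambda>(\<theta>, t). q \<theta> t) \<in> borel_measurable (M \<Otimes>\<^sub>M M)"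
    and q_nonneg: "q \<theta> t \<ge> 0"
    and q_prob: "prob_space (density M (\<lambda>t. ennreal (q \<theta> t)))"
    and H_fin: "integrable M (\<lambda>\<theta>. p \<theta> * hfun nu f y eps \<theta>)"
    and H_pos: "Hconst M p nu f y eps > 0"
    and q_tight: "\<forall>\<delta>>0. \<exists>r>0. \<forall>\<theta>.
                    measure (density M (\<lambda>t. ennreal (q \<theta> t))) (- ball \<theta> r) < \<delta>"
    and post_tail: "\<forall>r>0. measure (post M p nu f y eps) (- ball \<theta>0 r) > 0"
    and h_lim: "((\<lambda>v. SUP \<theta>\<in>- ball \<theta>0 v. hfun nu f y eps \<theta>) \<longlongrightarrow> 0) at_top"
    and N_pos: "N \<ge> 1"
begin

abbreviation "h \<equiv> hfun nu f y eps"
abbreviation "w \<equiv> wfun y eps"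
abbreviation "H \<equiv> Hconst M p nu f y eps"
abbreviation "NU \<equiv> PiM {..<N} (\<lambda>_. nu)"
abbreviation "W z \<equiv> (\<Sum>j<N. w (z j))"
abbreviation "F t z \<equiv> (\<Prod>j<N. f t (z j))"

text \<open>The acceptance ratios are bounded by the number of hits among the pseudo-observations
  times \<open>1 \<and> c(t,\<theta>)/c(\<theta>,t)\<close>. Hence \<open>k1\<close> and \<open>k2\<close> below only dominate the off-diagonal
  parts of the two transition kernels, which is all the argument needs. If \<open>p \<theta> * q \<theta> t = 0\<close> then
  \<open>kap \<theta> t = 0\<close>, since division by zero gives zero.\<close>

definition kap :: "'a \<Rightarrow> 'a \<Rightarrow> real" where
  "kap \<theta> t = q \<theta> t * min 1 (p t * q t \<theta> / (p \<theta> * q \<theta> t))"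

definition k1 :: "'a \<times> (nat \<Rightarrow> 'b) \<Rightarrow> 'a \<times> (nat \<Rightarrow> 'b) \<Rightarrow> ennreal" where
  "k1 a b = ennreal (kap (fst a) (fst b)) * ennreal (W (snd b) * F (fst b) (snd b))"

definition k2 :: "'a \<Rightarrow> 'a \<Rightarrow> ennreal" where
  "k2 \<theta> t = ennreal (kap \<theta> t) * ennreal (real N * h t)"

definition rho1 :: "'a \<times> (nat \<Rightarrow> 'b) \<Rightarrow> ennreal" where
  "rho1 a = ennreal (p (fst a) * F (fst a) (snd a) * W (snd a) / (real N * H))"

definition rho2 :: "'a \<Rightarrow> ennreal" where
  "rho2 \<theta> = ennreal (p \<theta> * h \<theta> / H)"

lemma space_M [simp]: "space M = UNIV" and space_nu [simp]: "space nu = UNIV"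
  using sets_eq_imp_space_eq[OF M_borel] sets_eq_imp_space_eq[OF nu_borel] by simp_all

lemma borel_M: "A \<in> sets borel \<Longrightarrow> A \<in> sets M" and borel_nu: "B \<in> sets borel \<Longrightarrow> B \<in> sets nu"
  by (simp_all add: M_borel nu_borel)

lemma UNIV_M [simp, measurable]: "UNIV \<in> sets M"
  using sets.top[of M] by simp

lemma ball_nu [measurable]: "ball x r \<in> sets nu"
  by (rule borel_nu) simp

lemma p_measurable [measurable (raw)]: "a \<in> measurable S M \<Longrightarrow> (\<lambda>s. p (a s)) \<in> borel_measurable S"
  by (rule measurable_compose[OF _ p_meas])

lemma f_measurable [measurable (raw)]:
  "a \<in> measurable S M \<Longrightarrow> b \<in> measurable S nu \<Longrightarrow> (\<lambda>s. f (a s) (b s)) \<in> borel_measurable S"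
  using measurable_compose[OF measurable_Pair f_meas] by simp

lemma q_measurable [measurable (raw)]:
  "a \<in> measurable S M \<Longrightarrow> b \<in> measurable S M \<Longrightarrow> (\<lambda>s. q (a s) (b s)) \<in> borel_measurable S"
  using measurable_compose[OF measurable_Pair q_meas] by simp

lemma kap_measurable [measurable (raw)]:
  "a \<in> measurable S M \<Longrightarrow> b \<in> measurable S M \<Longrightarrow> (\<lambda>s. kap (a s) (b s)) \<in> borel_measurable S"
  unfolding kap_def
  by (intro borel_measurable_min borel_measurable_divide borel_measurable_times borel_measurable_const
      q_measurable p_measurable)

lemma w_eq: "w x = indicator (ball y eps) x"
  by (auto simp: wfun_def indicator_def dist_commute)

lemma w_measurable [measurable]: "w \<in> borel_measurable nu"
  unfolding w_eq by measurable

lemma w_nonneg: "0 \<le> w x"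
  by (simp add: w_eq)

lemma sum_w_nonneg: "0 \<le> (\<Sum>j\<in>J. w (z j))"
  by (intro sum_nonneg w_nonneg)

lemma ennreal_h: "ennreal (h t) = emeasure (lik nu f t) (ball y eps)"
proof -
  interpret prob_space "lik nu f t" by (rule f_prob)
  show ?thesis by (simp add: hfun_def emeasure_eq_measure)
qed

lemma h_nonneg: "0 \<le> h t"
  by (simp add: hfun_def)

lemma h_le_1: "h t \<le> 1"
  using prob_space.prob_le_1[OF f_prob] by (simp add: hfun_def)

lemma h_measurable [measurable]: "h \<in> borel_measurable M"
proof -
  interpret sigma_finite_measure nu by (rule nu_sf)
  \<comment> \<open>As a nonnegative integral with parameter \<open>t\<close>, \<open>h\<close>
    inherits measurability from the joint measurability of \<open>f\<close>.\<close>
  have "h = (\<lambda>t. enn2real (\<integral>\<^sup>+x. ennreal (f t x) * indicator (ball y eps) x \<partial>nu))"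
    by (auto simp: hfun_def lik_def measure_def emeasure_density fun_eq_iff)
  also have "\<dots> \<in> borel_measurable M" by measurable
  finally show ?thesis .
qed

lemma prob_PiM_lik: "prob_space (PiM J (\<lambda>_. lik nu f t))"
  by (intro prob_space_PiM f_prob)

text \<open>By linearity only the coordinate laws matter: each is \<open>lik nu f t\<close>, under
  which \<open>w\<close>, the indicator of the ball around \<open>y\<close>, has mean
  \<open>h t\<close>.\<close>

lemma nn_integral_sum_w:
  "(\<integral>\<^sup>+z. ennreal (\<Sum>j<K. w (z j)) \<partial>PiM {..<K} (\<lambda>_. lik nu f t)) = ennreal (real K * h t)"
proof -
  have sl: "sets (lik nu f t) = sets nu" by (simp add: lik_def)
  have [measurable]: "w \<in> borel_measurable (lik nu f t)"
    by (simp add: lik_def)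
  have "(\<integral>\<^sup>+z. ennreal (w (z j)) \<partial>PiM {..<K} (\<lambda>_. lik nu f t)) = ennreal (h t)" if "j < K" for j
  proof -
    have "(\<integral>\<^sup>+z. ennreal (w (z j)) \<partial>PiM {..<K} (\<lambda>_. lik nu f t))
        = (\<integral>\<^sup>+x. ennreal (w x) \<partial>distr (PiM {..<K} (\<lambda>_. lik nu f t)) (lik nu f t) (\<lambda>z. z j))"
      using that by (subst nn_integral_distr) auto
    also have "\<dots> = (\<integral>\<^sup>+x. ennreal (w x) \<partial>lik nu f t)"
      using that by (subst distr_PiM_component[OF f_prob]) auto
    also have "\<dots> = (\<integral>\<^sup>+x. indicator (ball y eps) x \<partial>lik nu f t)"
      by (intro nn_integral_cong) (simp add: w_eq indicator_def)
    also have "\<dots> = ennreal (h t)"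
      using sl by (simp add: ennreal_h)
    finally show ?thesis .
  qed
  moreover have "(\<integral>\<^sup>+z. ennreal (\<Sum>j<K. w (z j)) \<partial>PiM {..<K} (\<lambda>_. lik nu f t))
     = (\<Sum>j<K. \<integral>\<^sup>+z. ennreal (w (z j)) \<partial>PiM {..<K} (\<lambda>_. lik nu f t))"
    by (subst nn_integral_sum[symmetric])
      (auto simp: sum_ennreal w_nonneg intro!: measurable_compose[OF measurable_component_singleton])
  ultimately show ?thesis
    using h_nonneg by (simp add: ennreal_mult ennreal_of_nat_eq_real_of_nat)
qed

lemma PiM_lik: "PiM {..<N} (\<lambda>_. lik nu f t) = density NU (\<lambda>z. ennreal (F t z))"
proof -
  have "PiM {..<N} (\<lambda>_. lik nu f t) = density NU (\<lambda>z. \<Prod>j<N. ennreal (f t (z j)))"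
    unfolding lik_def
    by (rule PiM_density)
      (auto simp: nu_sf lik_def[symmetric] intro!: prob_space_imp_sigma_finite f_prob)
  then show ?thesis
    using f_nonneg by (simp add: prod_ennreal)
qed

lemma F_nonneg: "0 \<le> F t z"
  by (simp add: prod_nonneg f_nonneg)

lemma nn_integral_W_F: "(\<integral>\<^sup>+z. ennreal (W z * F t z) \<partial>NU) = ennreal (real N * h t)"
proof -
  have "(\<integral>\<^sup>+z. ennreal (W z * F t z) \<partial>NU) = (\<integral>\<^sup>+z. ennreal (F t z) * ennreal (W z) \<partial>NU)"
    by (intro nn_integral_cong) (simp add: ennreal_mult[OF F_nonneg sum_w_nonneg, symmetric] mult.commute)
  also have "\<dots> = (\<integral>\<^sup>+z. ennreal (W z) \<partial>PiM {..<N} (\<lambda>_. lik nu f t))"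
    unfolding PiM_lik by (subst nn_integral_density) auto
  finally show ?thesis by (simp add: nn_integral_sum_w)
qed

lemma kap_nonneg: "0 \<le> kap \<theta> t"
  by (simp add: kap_def q_nonneg p_nonneg)

lemma kap_le_q: "kap \<theta> t \<le> q \<theta> t"
  unfolding kap_def using q_nonneg[of \<theta> t] by (intro mult_left_le) auto

text \<open>The left-hand side is the Metropolis-Hastings flow, that is, the minimum of
  \<open>p \<theta> * q \<theta> t\<close> and \<open>p t * q t \<theta>\<close>. Bounding it by the
  reverse proposal flow is the source of sub-invariance for both chains.\<close>

lemma p_kap_le: "p \<theta> * kap \<theta> t \<le> p t * q t \<theta>"
proof (cases "p \<theta> * q \<theta> t = 0")
  case True
  then show ?thesis using p_nonneg q_nonneg by (auto simp: kap_def)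
next
  case False
  then have pos: "p \<theta> * q \<theta> t > 0" using p_nonneg[of \<theta>] q_nonneg[of \<theta> t] by (simp add: order_less_le)
  have "p \<theta> * kap \<theta> t = (p \<theta> * q \<theta> t) * min 1 (p t * q t \<theta> / (p \<theta> * q \<theta> t))"
    by (simp add: kap_def)
  also have "\<dots> \<le> (p \<theta> * q \<theta> t) * (p t * q t \<theta> / (p \<theta> * q \<theta> t))"
    using pos by (intro mult_left_mono) auto
  finally show ?thesis using False by simp
qed

section \<open>Normalisation and marginals of the two targets\<close>

lemma NU_sf: "sigma_finite_measure NU"
proof -
  interpret product_sigma_finite "\<lambda>_::nat. nu" by (intro product_sigma_finite.intro nu_sf)
  show ?thesis by (rule sigma_finite) simp
qed

lemma nn_integral_q: "(\<integral>\<^sup>+t. ennreal (q \<theta> t) \<partial>M) = 1"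
  using prob_space.emeasure_space_1[OF q_prob[of \<theta>]] by (simp add: emeasure_density)

lemma nn_integral_rho2: "(\<integral>\<^sup>+\<theta>. rho2 \<theta> \<partial>M) = 1"
proof -
  have "(\<integral>\<^sup>+\<theta>. rho2 \<theta> \<partial>M) = ennreal (\<integral>\<theta>. p \<theta> * h \<theta> / H \<partial>M)"
    unfolding rho2_def using H_fin H_pos p_nonneg h_nonneg
    by (intro nn_integral_eq_integral) (auto intro!: AE_I2)
  also have "(\<integral>\<theta>. p \<theta> * h \<theta> / H \<partial>M) = 1"
    using H_pos by (simp add: Hconst_def)
  finally show ?thesis by simp
qed

lemma rho2_measurable [measurable]: "rho2 \<in> borel_measurable M"
  unfolding rho2_def by measurable

lemma post_eq: "post M p nu f y eps = density M rho2"
  by (simp add: post_def rho2_def[abs_def])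

lemma prob_post: "prob_space (density M rho2)"
  using nn_integral_rho2 by (intro prob_spaceI) (simp add: emeasure_density)

lemma rho1_measurable [measurable]: "rho1 \<in> borel_measurable (M \<Otimes>\<^sub>M NU)"
  unfolding rho1_def by measurable

lemma ext_post_eq: "ext_post N M p nu f y eps = density (M \<Otimes>\<^sub>M NU) rho1"
  by (simp add: ext_post_def rho1_def[abs_def] case_prod_beta')

text \<open>Integrating \<open>W\<close> against the likelihood \<open>F\<close> gives
  \<open>N * h \<theta>\<close>, whose factor \<open>N \<ge> 1\<close> cancels in the normalising
  constant. The identity transfers both total mass 1 and the positive mass of the tail sets to the
  extended space.\<close>

lemma emeasure_ext_post:
  assumes A: "A \<in> sets M"
  shows "emeasure (density (M \<Otimes>\<^sub>M NU) rho1) (A \<times> space NU) = emeasure (density M rho2) A"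
proof -
  interpret N: sigma_finite_measure NU by (rule NU_sf)
  note A [measurable]
  have "emeasure (density (M \<Otimes>\<^sub>M NU) rho1) (A \<times> space NU)
      = (\<integral>\<^sup>+a. rho1 a * indicator (A \<times> space NU) a \<partial>(M \<Otimes>\<^sub>M NU))"
    by (subst emeasure_density) auto
  also have "\<dots> = (\<integral>\<^sup>+\<theta>. \<integral>\<^sup>+x. rho1 (\<theta>, x) * indicator (A \<times> space NU) (\<theta>, x) \<partial>NU \<partial>M)"
    by (subst N.nn_integral_fst[symmetric]) auto
  also have "\<dots> = (\<integral>\<^sup>+\<theta>. rho2 \<theta> * indicator A \<theta> \<partial>M)"
  proof (rule nn_integral_cong)
    fix \<theta>
    have "(\<integral>\<^sup>+x. rho1 (\<theta>, x) * indicator (A \<times> space NU) (\<theta>, x) \<partial>NU)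
        = (\<integral>\<^sup>+x. ennreal (p \<theta> / (real N * H)) * indicator A \<theta> * ennreal (W x * F \<theta> x) \<partial>NU)"
      using p_nonneg H_pos F_nonneg sum_w_nonneg
      by (intro nn_integral_cong)
        (auto simp: rho1_def ennreal_mult'[symmetric] indicator_def mult_ac)
    also have "\<dots> = ennreal (p \<theta> / (real N * H)) * indicator A \<theta> * ennreal (real N * h \<theta>)"
      by (subst nn_integral_cmult) (auto simp: nn_integral_W_F)
    also have "\<dots> = rho2 \<theta> * indicator A \<theta>"
      using p_nonneg H_pos h_nonneg N_pos
      by (auto simp: rho2_def ennreal_mult'[symmetric] indicator_def)
    finally show "(\<integral>\<^sup>+x. rho1 (\<theta>, x) * indicator (A \<times> space NU) (\<theta>, x) \<partial>NU) = rho2 \<theta> * indicator A \<theta>" .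
  qed
  also have "\<dots> = emeasure (density M rho2) A"
    by (subst emeasure_density) auto
  finally show ?thesis .
qed

lemma prob_ext_post: "prob_space (density (M \<Otimes>\<^sub>M NU) rho1)"
  using emeasure_ext_post[of UNIV] sets.top[of M] prob_space.emeasure_space_1[OF prob_post]
  by (intro prob_spaceI) (simp add: space_pair_measure)

section \<open>Tail sets of the parameter space\<close>

text \<open>Since \<open>kap \<le> q\<close>, this is \<open>proposal_tail_small\<close> at level
  \<open>e / N\<close>. The integral is the mass of both \<open>k2 \<theta>\<close> and
  \<open>k1 (\<theta>, x)\<close>, so one estimate serves both chains.\<close>

lemma tail_small:
  assumes "e > 0"
  shows "\<exists>n0. \<forall>n\<ge>n0. \<forall>\<theta>\<in>- ball \<theta>0 (real n).
    (\<integral>\<^sup>+t. ennreal (kap \<theta> t) * ennreal (real N * h t) \<partial>M) \<le> ennreal e"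
proof -
  have qm: "q \<theta> \<in> borel_measurable M" for \<theta>
    by (rule q_measurable[of "\<lambda>_. \<theta>" M "\<lambda>t. t"]) auto
  have pos: "0 < e / real N" using assms N_pos by simp
  have "\<exists>v0. \<forall>v\<ge>v0. \<forall>\<theta>\<in>- ball \<theta>0 v.
      (\<integral>\<^sup>+t. ennreal (q \<theta> t) * ennreal (h t) \<partial>M) \<le> ennreal (e / real N)"
    by (rule proposal_tail_small[where M = M and q = q and h = h,
        OF M_borel qm q_prob q_tight h_nonneg h_le_1 h_lim pos])
  then obtain v0 where v0: "\<forall>v\<ge>v0. \<forall>\<theta>\<in>- ball \<theta>0 v.
      (\<integral>\<^sup>+t. ennreal (q \<theta> t) * ennreal (h t) \<partial>M) \<le> ennreal (e / real N)" ..
  show ?thesis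
  proof (intro exI[of _ "nat \<lceil>v0\<rceil>"] allI impI ballI)
    fix n \<theta> assume n: "nat \<lceil>v0\<rceil> \<le> n" and \<theta>: "\<theta> \<in> - ball \<theta>0 (real n)"
    have "(\<integral>\<^sup>+t. ennreal (kap \<theta> t) * ennreal (real N * h t) \<partial>M)
        \<le> (\<integral>\<^sup>+t. ennreal (real N) * (ennreal (q \<theta> t) * ennreal (h t)) \<partial>M)"
    proof (rule nn_integral_mono)
      fix t
      have "ennreal (kap \<theta> t) * ennreal (real N * h t) \<le> ennreal (q \<theta> t) * ennreal (real N * h t)"
        by (intro mult_right_mono ennreal_leI kap_le_q) simp
      then show "ennreal (kap \<theta> t) * ennreal (real N * h t) \<le> ennreal (real N) * (ennreal (q \<theta> t) * ennreal (h t))"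
        by (simp only: ennreal_mult''[OF h_nonneg] mult.left_commute[of "ennreal (real N)"])
    qed
    also have "\<dots> = ennreal (real N) * (\<integral>\<^sup>+t. ennreal (q \<theta> t) * ennreal (h t) \<partial>M)"
      by (rule nn_integral_cmult) measurable
    also have "\<dots> \<le> ennreal (real N) * ennreal (e / real N)"
      using n \<theta> by (intro mult_left_mono v0[rule_format, of "real n"]) (simp_all add: nat_ceiling_le_eq)
    also have "\<dots> = ennreal e"
      using assms N_pos by (simp flip: ennreal_mult)
    finally show "(\<integral>\<^sup>+t. ennreal (kap \<theta> t) * ennreal (real N * h t) \<partial>M) \<le> ennreal e" .
  qed
qed

lemma tail_props:
  "- ball \<theta>0 (real n) \<in> sets M" "decseq (\<lambda>n. - ball \<theta>0 (real n))" "(\<Inter>n. - ball \<theta>0 (real n)) = {}"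
  "emeasure (density M rho2) (- ball \<theta>0 (real n)) > 0"
proof -
  show mt: "- ball \<theta>0 (real n) \<in> sets M" for n by (rule borel_M) auto
  show "decseq (\<lambda>n. - ball \<theta>0 (real n))"
    by (auto simp: decseq_def)
  show "(\<Inter>n. - ball \<theta>0 (real n)) = {}"
  proof (intro equals0I)
    fix \<theta> assume \<theta>: "\<theta> \<in> (\<Inter>n. - ball \<theta>0 (real n))"
    obtain n where "dist \<theta>0 \<theta> < real n" using reals_Archimedean2 by blast
    with \<theta> show False by auto
  qed
  \<comment> \<open>The hypothesis \<open>post_tail\<close> speaks of positive radii only; passing
    to \<open>Suc n\<close> also covers \<open>n = 0\<close>.\<close>
  have "0 < emeasure (density M rho2) (- ball \<theta>0 (real (Suc n)))"
    using post_tail[rule_format, of "real (Suc n)"] by (simp add: post_eq measure_def enn2real_positive_iff)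
  also have "\<dots> \<le> emeasure (density M rho2) (- ball \<theta>0 (real n))"
    using mt by (intro emeasure_mono) auto
  finally show "emeasure (density M rho2) (- ball \<theta>0 (real n)) > 0" .
qed

section \<open>Bounds on the acceptance probabilities\<close>

text \<open>Integrality makes a nonzero hit count at least 1, the form in which
  \<open>min_ratio_le\<close> can be applied.\<close>

lemma sum_w_nat: obtains m :: nat where "(\<Sum>j\<in>J. w (z j)) = real m"
proof
  show "(\<Sum>j\<in>J. w (z j)) = real (\<Sum>j\<in>J. if z j \<in> ball y eps then 1 else 0)"
    by (auto simp: w_eq indicator_def intro!: sum.cong)
qed

lemma alpha1_nonneg: "0 \<le> alpha1 N p q y eps \<theta> x t z"
  unfolding alpha1_def by (intro min.boundedI divide_nonneg_nonneg mult_nonneg_nonneg p_nonneg q_nonneg sum_w_nonneg) simp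

lemma q_alpha1_le: "q \<theta> t * alpha1 N p q y eps \<theta> x t z \<le> kap \<theta> t * W z"
proof -
  obtain m where m: "W z = real m" using sum_w_nat by blast
  obtain m' where m': "W x = real m'" using sum_w_nat by blast
  have "alpha1 N p q y eps \<theta> x t z \<le> real m * min 1 (p t * q t \<theta> / (p \<theta> * q \<theta> t))"
    unfolding alpha1_def m m' using p_nonneg q_nonneg by (intro min_ratio_le) auto
  then show ?thesis
    using mult_left_mono[OF _ q_nonneg[of \<theta> t]] by (simp only: kap_def m mult.assoc mult.commute[of "min 1 _" "real m"])
qed

text \<open>The denominator is at least 1 because of the added hit, so \<open>min_ratio_le\<close>
  bounds the integrand by \<open>W z\<close> times a factor free of \<open>x\<close> and
  \<open>z\<close>. The inner integral is then over a probability measure, and the outer one yields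
  the expected hit count \<open>N * h t\<close>.\<close>

lemma q_alpha2_le: "ennreal (q \<theta> t * \<bar>alpha2 N p q nu f y eps \<theta> t\<bar>) \<le> k2 \<theta> t"
proof -
  let ?r = "p t * q t \<theta> / (p \<theta> * q \<theta> t)"
  let ?Lt = "PiM {..<N} (\<lambda>_. lik nu f t)" and ?L\<theta> = "PiM {..<N - 1} (\<lambda>_. lik nu f \<theta>)"
  interpret X: prob_space ?L\<theta> by (rule prob_PiM_lik)
  have W_meas: "(\<lambda>z. ennreal (W z)) \<in> borel_measurable ?Lt"
    unfolding PiM_lik by simp
  have r: "0 \<le> min 1 ?r" using p_nonneg q_nonneg by simp
  have "ennreal \<bar>alpha2 N p q nu f y eps \<theta> t\<bar> \<le> (\<integral>\<^sup>+z. (\<integral>\<^sup>+x.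
      ennreal \<bar>min 1 ((p t * q t \<theta> * W z) / (p \<theta> * q \<theta> t * (1 + (\<Sum>j<N - 1. w (x j)))))\<bar> \<partial>?L\<theta>) \<partial>?Lt)"
    unfolding alpha2_def
    by (intro order_trans[OF abs_integral_le_nn_integral] nn_integral_mono abs_integral_le_nn_integral)
  also have "\<dots> \<le> (\<integral>\<^sup>+z. (\<integral>\<^sup>+x. ennreal (min 1 ?r) * ennreal (W z) \<partial>?L\<theta>) \<partial>?Lt)"
  proof (intro nn_integral_mono)
    fix z x
    let ?d = "1 + (\<Sum>j<N - 1. w (x j))"
    obtain m where m: "W z = real m" using sum_w_nat by blast
    have d: "1 \<le> ?d" using sum_w_nonneg by simp
    have "0 \<le> min 1 ((p t * q t \<theta> * W z) / (p \<theta> * q \<theta> t * ?d))"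
      using d by (intro min.boundedI divide_nonneg_nonneg mult_nonneg_nonneg p_nonneg q_nonneg sum_w_nonneg) auto
    moreover have "min 1 ((p t * q t \<theta> * W z) / (p \<theta> * q \<theta> t * ?d)) \<le> W z * min 1 ?r"
      unfolding m using p_nonneg q_nonneg d by (intro min_ratio_le) auto
    ultimately show "ennreal \<bar>min 1 ((p t * q t \<theta> * W z) / (p \<theta> * q \<theta> t * ?d))\<bar>
        \<le> ennreal (min 1 ?r) * ennreal (W z)"
      by (simp only: ennreal_mult'[OF r, symmetric] mult.commute[of "min 1 ?r" "W z"] abs_of_nonneg ennreal_leI)
  qed
  also have "\<dots> = ennreal (min 1 ?r) * ennreal (real N * h t)"
    using W_meas X.emeasure_space_1 by (simp add: nn_integral_cmult nn_integral_sum_w)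
  finally have "ennreal (q \<theta> t) * ennreal \<bar>alpha2 N p q nu f y eps \<theta> t\<bar>
      \<le> ennreal (q \<theta> t) * (ennreal (min 1 ?r) * ennreal (real N * h t))"
    by (rule mult_left_mono) simp
  then show ?thesis
    using q_nonneg by (simp only: k2_def kap_def ennreal_mult'[OF q_nonneg] mult.assoc)
qed

section \<open>Mass and sub-invariance of the dominating kernels\<close>

lemma k1_measurable: "(\<lambda>(a, b). k1 a b) \<in> borel_measurable ((M \<Otimes>\<^sub>M NU) \<Otimes>\<^sub>M (M \<Otimes>\<^sub>M NU))"
  unfolding k1_def by measurable

lemma k2_measurable: "(\<lambda>(a, b). k2 a b) \<in> borel_measurable (M \<Otimes>\<^sub>M M)"
  unfolding k2_def by measurable

text \<open>Integrating out the proposed pseudo-observations replaces \<open>W z * F t z\<close> by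
  \<open>N * h t\<close>, and \<open>k1\<close> is free of the current ones. Hence both chains share
  the same escape bound.\<close>

lemma nn_integral_k1: "(\<integral>\<^sup>+b. k1 (\<theta>, x) b \<partial>(M \<Otimes>\<^sub>M NU)) = (\<integral>\<^sup>+t. k2 \<theta> t \<partial>M)"
proof -
  interpret N: sigma_finite_measure NU by (rule NU_sf)
  have [measurable]: "k1 (\<theta>, x) \<in> borel_measurable (M \<Otimes>\<^sub>M NU)"
    unfolding k1_def by measurable
  have "(\<integral>\<^sup>+b. k1 (\<theta>, x) b \<partial>(M \<Otimes>\<^sub>M NU)) = (\<integral>\<^sup>+t. \<integral>\<^sup>+z. k1 (\<theta>, x) (t, z) \<partial>NU \<partial>M)"
    by (rule N.nn_integral_fst[symmetric]) measurable
  also have "\<dots> = (\<integral>\<^sup>+t. k2 \<theta> t \<partial>M)"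
    unfolding k1_def k2_def by (intro nn_integral_cong) (simp add: nn_integral_cmult nn_integral_W_F)
  finally show ?thesis .
qed

text \<open>By \<open>p_kap_le\<close> and \<open>h \<theta> \<le> 1\<close> the integrand is at
  most \<open>N * rho2 t\<close> times the reverse proposal density \<open>q t \<theta>\<close>,
  which integrates to 1 in \<open>\<theta>\<close>.\<close>

lemma k2_inv: "(\<integral>\<^sup>+\<theta>. rho2 \<theta> * k2 \<theta> t \<partial>M) \<le> ennreal (real N) * rho2 t"
proof -
  have "rho2 \<theta> * k2 \<theta> t \<le> ennreal (real N) * rho2 t * ennreal (q t \<theta>)" for \<theta>
  proof -
    have "p \<theta> * h \<theta> / H * (kap \<theta> t * (real N * h t)) = (p \<theta> * kap \<theta> t) * h \<theta> * (real N * h t / H)"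
      by simp
    also have "\<dots> \<le> (p t * q t \<theta>) * 1 * (real N * h t / H)"
      using p_nonneg kap_nonneg q_nonneg h_nonneg H_pos h_le_1
      by (intro mult_right_mono mult_mono p_kap_le) auto
    finally have "ennreal (p \<theta> * h \<theta> / H * (kap \<theta> t * (real N * h t)))
        \<le> ennreal (real N * (p t * h t / H) * q t \<theta>)"
      by (intro ennreal_leI) (simp add: mult_ac)
    then show ?thesis
      unfolding rho2_def k2_def using p_nonneg kap_nonneg q_nonneg h_nonneg H_pos
      by (simp add: ennreal_mult[symmetric])
  qed
  then have "(\<integral>\<^sup>+\<theta>. rho2 \<theta> * k2 \<theta> t \<partial>M) \<le> (\<integral>\<^sup>+\<theta>. ennreal (real N) * rho2 t * ennreal (q t \<theta>) \<partial>M)"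
    by (intro nn_integral_mono)
  also have "\<dots> = ennreal (real N) * rho2 t * (\<integral>\<^sup>+\<theta>. ennreal (q t \<theta>) \<partial>M)"
    by (rule nn_integral_cmult) measurable
  finally show ?thesis by (simp add: nn_integral_q)
qed

text \<open>After \<open>p_kap_le\<close> the factors in \<open>z\<close> regroup to
  \<open>rho1 (t, z)\<close>, while those in \<open>x\<close> integrate to
  \<open>N * h \<theta> \<le> N\<close>; the remaining \<open>q t \<theta>\<close> integrates to
  1.\<close>

lemma k1_inv: "(\<integral>\<^sup>+a. rho1 a * k1 a (t, z) \<partial>(M \<Otimes>\<^sub>M NU)) \<le> ennreal (real N) * rho1 (t, z)"
proof -
  interpret N: sigma_finite_measure NU by (rule NU_sf)
  have [measurable]: "(\<lambda>a. k1 a (t, z)) \<in> borel_measurable (M \<Otimes>\<^sub>M NU)"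
    unfolding k1_def by measurable
  have le: "rho1 (\<theta>, x) * k1 (\<theta>, x) (t, z)
      \<le> rho1 (t, z) * ennreal (q t \<theta>) * ennreal (W x * F \<theta> x)" for \<theta> x
  proof -
    have "p \<theta> * F \<theta> x * W x / (real N * H) * (kap \<theta> t * (W z * F t z))
        = (p \<theta> * kap \<theta> t) * (F \<theta> x * W x * (W z * F t z) / (real N * H))"
      by simp
    also have "\<dots> \<le> (p t * q t \<theta>) * (F \<theta> x * W x * (W z * F t z) / (real N * H))"
      using H_pos by (intro mult_right_mono p_kap_le divide_nonneg_nonneg mult_nonneg_nonneg F_nonneg sum_w_nonneg) auto
    finally have "ennreal (p \<theta> * F \<theta> x * W x / (real N * H) * (kap \<theta> t * (W z * F t z)))
        \<le> ennreal (p t * F t z * W z / (real N * H) * q t \<theta> * (W x * F \<theta> x))"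
      by (intro ennreal_leI) (simp add: mult_ac)
    moreover have "0 \<le> p \<theta> * F \<theta> x * W x / (real N * H)" for \<theta> x
      using H_pos by (intro divide_nonneg_nonneg mult_nonneg_nonneg p_nonneg F_nonneg sum_w_nonneg) auto
    ultimately show ?thesis
      unfolding rho1_def k1_def fst_conv snd_conv
      by (simp only: ennreal_mult'[symmetric] kap_nonneg q_nonneg mult_nonneg_nonneg)
  qed
  have "(\<integral>\<^sup>+a. rho1 a * k1 a (t, z) \<partial>(M \<Otimes>\<^sub>M NU)) = (\<integral>\<^sup>+\<theta>. \<integral>\<^sup>+x. rho1 (\<theta>, x) * k1 (\<theta>, x) (t, z) \<partial>NU \<partial>M)"
    by (rule N.nn_integral_fst[symmetric]) measurable
  also have "\<dots> \<le> (\<integral>\<^sup>+\<theta>. \<integral>\<^sup>+x. rho1 (t, z) * ennreal (q t \<theta>) * ennreal (W x * F \<theta> x) \<partial>NU \<partial>M)"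
    by (intro nn_integral_mono le)
  also have "\<dots> = (\<integral>\<^sup>+\<theta>. rho1 (t, z) * ennreal (q t \<theta>) * ennreal (real N * h \<theta>) \<partial>M)"
    by (intro nn_integral_cong) (simp add: nn_integral_cmult nn_integral_W_F)
  also have "\<dots> \<le> (\<integral>\<^sup>+\<theta>. rho1 (t, z) * ennreal (real N) * ennreal (q t \<theta>) \<partial>M)"
  proof (intro nn_integral_mono)
    fix \<theta>
    have "rho1 (t, z) * ennreal (q t \<theta>) * ennreal (real N * h \<theta>)
        \<le> rho1 (t, z) * ennreal (q t \<theta>) * ennreal (real N * 1)"
      by (intro mult_left_mono ennreal_leI h_le_1) auto
    then show "rho1 (t, z) * ennreal (q t \<theta>) * ennreal (real N * h \<theta>)
        \<le> rho1 (t, z) * ennreal (real N) * ennreal (q t \<theta>)"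
      by (simp add: mult_ac)
  qed
  also have "\<dots> = rho1 (t, z) * ennreal (real N) * (\<integral>\<^sup>+\<theta>. ennreal (q t \<theta>) \<partial>M)"
    by (rule nn_integral_cmult) measurable
  finally show ?thesis by (simp add: nn_integral_q mult.commute)
qed

section \<open>Passage from the dominating kernels to the two chains\<close>

lemma P1_integral_le:
  assumes g [measurable]: "g \<in> borel_measurable (M \<Otimes>\<^sub>M NU)"
  shows "ennreal \<bar>\<integral>t. q \<theta> t * (\<integral>z. alpha1 N p q y eps \<theta> x t z * g (t, z)
      \<partial>PiM {..<N} (\<lambda>_. lik nu f t)) \<partial>M\<bar>
    \<le> (\<integral>\<^sup>+b. k1 (\<theta>, x) b * ennreal \<bar>g b\<bar> \<partial>(M \<Otimes>\<^sub>M NU))"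
proof -
  interpret N: sigma_finite_measure NU by (rule NU_sf)
  let ?L = "\<lambda>t. PiM {..<N} (\<lambda>_. lik nu f t)"
  let ?\<alpha> = "\<lambda>t z. alpha1 N p q y eps \<theta> x t z"
  have [measurable]: "k1 (\<theta>, x) \<in> borel_measurable (M \<Otimes>\<^sub>M NU)"
    unfolding k1_def by measurable
  have "ennreal \<bar>\<integral>t. q \<theta> t * (\<integral>z. ?\<alpha> t z * g (t, z) \<partial>?L t) \<partial>M\<bar>
      \<le> (\<integral>\<^sup>+t. ennreal \<bar>q \<theta> t * (\<integral>z. ?\<alpha> t z * g (t, z) \<partial>?L t)\<bar> \<partial>M)"
    by (rule abs_integral_le_nn_integral)
  also have "\<dots> \<le> (\<integral>\<^sup>+t. \<integral>\<^sup>+z. k1 (\<theta>, x) (t, z) * ennreal \<bar>g (t, z)\<bar> \<partial>NU \<partial>M)"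
  proof (rule nn_integral_mono)
    fix t
    have "ennreal \<bar>q \<theta> t * (\<integral>z. ?\<alpha> t z * g (t, z) \<partial>?L t)\<bar>
        = ennreal \<bar>\<integral>z. q \<theta> t * (?\<alpha> t z * g (t, z)) \<partial>?L t\<bar>"
      by simp
    also have "\<dots> \<le> (\<integral>\<^sup>+z. ennreal \<bar>q \<theta> t * (?\<alpha> t z * g (t, z))\<bar> \<partial>?L t)"
      by (rule abs_integral_le_nn_integral)
    also have "\<dots> \<le> (\<integral>\<^sup>+z. ennreal (kap \<theta> t * W z * \<bar>g (t, z)\<bar>) \<partial>?L t)"
    proof (intro nn_integral_mono ennreal_leI)
      fix z
      have "\<bar>q \<theta> t * (?\<alpha> t z * g (t, z))\<bar> = q \<theta> t * ?\<alpha> t z * \<bar>g (t, z)\<bar>"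
        using q_nonneg alpha1_nonneg by (simp add: abs_mult)
      also have "\<dots> \<le> kap \<theta> t * W z * \<bar>g (t, z)\<bar>"
        by (intro mult_right_mono q_alpha1_le) simp
      finally show "\<bar>q \<theta> t * (?\<alpha> t z * g (t, z))\<bar> \<le> kap \<theta> t * W z * \<bar>g (t, z)\<bar>" .
    qed
    \<comment> \<open>Changing to the base measure \<open>NU\<close> brings in the likelihood
      \<open>F t z\<close>, the factor still missing from \<open>k1\<close>.\<close>
    also have "\<dots> = (\<integral>\<^sup>+z. ennreal (F t z) * ennreal (kap \<theta> t * W z * \<bar>g (t, z)\<bar>) \<partial>NU)"
      unfolding PiM_lik by (rule nn_integral_density) measurable
    also have "\<dots> = (\<integral>\<^sup>+z. k1 (\<theta>, x) (t, z) * ennreal \<bar>g (t, z)\<bar> \<partial>NU)"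
    proof (rule nn_integral_cong)
      fix z
      have "ennreal (F t z) * ennreal (kap \<theta> t * W z * \<bar>g (t, z)\<bar>)
          = ennreal (kap \<theta> t * (W z * F t z) * \<bar>g (t, z)\<bar>)"
        unfolding ennreal_mult'[OF F_nonneg, symmetric] by (simp only: mult_ac)
      also have "\<dots> = k1 (\<theta>, x) (t, z) * ennreal \<bar>g (t, z)\<bar>"
        by (simp only: k1_def fst_conv snd_conv ennreal_mult'[OF kap_nonneg] ennreal_mult''[OF abs_ge_zero])
      finally show "ennreal (F t z) * ennreal (kap \<theta> t * W z * \<bar>g (t, z)\<bar>)
          = k1 (\<theta>, x) (t, z) * ennreal \<bar>g (t, z)\<bar>" .
    qed
    finally show "ennreal \<bar>q \<theta> t * (\<integral>z. ?\<alpha> t z * g (t, z) \<partial>?L t)\<bar>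
        \<le> (\<integral>\<^sup>+z. k1 (\<theta>, x) (t, z) * ennreal \<bar>g (t, z)\<bar> \<partial>NU)" .
  qed
  also have "\<dots> = (\<integral>\<^sup>+b. k1 (\<theta>, x) b * ennreal \<bar>g b\<bar> \<partial>(M \<Otimes>\<^sub>M NU))"
    by (rule N.nn_integral_fst) measurable
  finally show ?thesis .
qed

lemma P2_integral_le:
  "ennreal \<bar>\<integral>t. q \<theta> t * alpha2 N p q nu f y eps \<theta> t * g t \<partial>M\<bar>
    \<le> (\<integral>\<^sup>+t. k2 \<theta> t * ennreal \<bar>g t\<bar> \<partial>M)"
proof -
  have "ennreal \<bar>q \<theta> t * alpha2 N p q nu f y eps \<theta> t * g t\<bar> \<le> k2 \<theta> t * ennreal \<bar>g t\<bar>" for t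
    using mult_right_mono[OF q_alpha2_le[of \<theta> t], of "ennreal \<bar>g t\<bar>"] q_nonneg[of \<theta> t]
    by (simp add: abs_mult ennreal_mult''[symmetric])
  then show ?thesis
    by (intro order_trans[OF abs_integral_le_nn_integral] nn_integral_mono)
qed

lemma P2_not_variance_bounding:
  "\<not> variance_bounding (post M p nu f y eps) (P2op N M p q nu f y eps)"
  unfolding post_eq
proof (rule not_variance_bounding_kernel[OF M_sf rho2_measurable prob_post k2_measurable tail_props])
  show "\<exists>n0. \<forall>n\<ge>n0. \<forall>\<theta>\<in>- ball \<theta>0 (real n). (\<integral>\<^sup>+t. k2 \<theta> t \<partial>M) \<le> ennreal e" if "e > 0" for e
    unfolding k2_def by (rule tail_small[OF that])
  show "(\<integral>\<^sup>+\<theta>. rho2 \<theta> * k2 \<theta> t \<partial>M) \<le> ennreal (real N) * rho2 t" for t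
    by (rule k2_inv)
  show "ennreal \<bar>P2op N M p q nu f y eps u \<theta> - u \<theta>\<bar>
      \<le> (\<integral>\<^sup>+t. k2 \<theta> t * ennreal \<bar>u t\<bar> \<partial>M) + (\<integral>\<^sup>+t. k2 \<theta> t \<partial>M) * ennreal \<bar>u \<theta>\<bar>" for u \<theta>
    unfolding P2op_def
    \<comment> \<open>With the constant function 1 the same estimate bounds the total acceptance
      probability.\<close>
    using P2_integral_le[of \<theta> "\<lambda>_. 1"] by (intro abs_perturbation_le P2_integral_le) simp
qed simp

text \<open>The test sets are cylinders over the tail sets in \<open>\<theta>\<close>: the escape
  bound is uniform in the current pseudo-observations, so these stay unrestricted.\<close>

lemma P1_not_variance_bounding:
  "\<not> variance_bounding (ext_post N M p nu f y eps) (P1op N M p q nu f y eps)"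
  unfolding ext_post_eq
proof (rule not_variance_bounding_kernel[where A = "\<lambda>n. (- ball \<theta>0 (real n)) \<times> space NU",
      OF _ rho1_measurable prob_ext_post k1_measurable])
  interpret pair_sigma_finite M NU
    by (intro pair_sigma_finite.intro M_sf NU_sf)
  show "sigma_finite_measure (M \<Otimes>\<^sub>M NU)" by (rule sigma_finite_measure_axioms)
  show "(- ball \<theta>0 (real n)) \<times> space NU \<in> sets (M \<Otimes>\<^sub>M NU)" for n
    by (intro pair_measureI tail_props) simp
  show "decseq (\<lambda>n. (- ball \<theta>0 (real n)) \<times> space NU)"
    using tail_props(2) by (auto simp: decseq_def)
  show "(\<Inter>n. (- ball \<theta>0 (real n)) \<times> space NU) = {}"
    using tail_props(3) by blast
  show "0 < emeasure (density (M \<Otimes>\<^sub>M NU) rho1) ((- ball \<theta>0 (real n)) \<times> space NU)" for n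
    by (simp only: emeasure_ext_post[OF tail_props(1)] tail_props)
  show "\<exists>n0. \<forall>n\<ge>n0. \<forall>a\<in>(- ball \<theta>0 (real n)) \<times> space NU. (\<integral>\<^sup>+b. k1 a b \<partial>(M \<Otimes>\<^sub>M NU)) \<le> ennreal e"
    if "e > 0" for e
    using tail_small[OF that] by (fastforce simp: nn_integral_k1 k2_def)
  show "(\<integral>\<^sup>+a. rho1 a * k1 a b \<partial>(M \<Otimes>\<^sub>M NU)) \<le> ennreal (real N) * rho1 b" for b
    by (cases b) (simp only: k1_inv)
  show "ennreal \<bar>P1op N M p q nu f y eps u a - u a\<bar>
      \<le> (\<integral>\<^sup>+b. k1 a b * ennreal \<bar>u b\<bar> \<partial>(M \<Otimes>\<^sub>M NU)) + (\<integral>\<^sup>+b. k1 a b \<partial>(M \<Otimes>\<^sub>M NU)) * ennreal \<bar>u a\<bar>"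
    if u: "u \<in> borel_measurable (M \<Otimes>\<^sub>M NU)" for u a
  proof (cases a)
    case (Pair \<theta> x)
    show ?thesis
      unfolding P1op_def Pair prod.case
      using P1_integral_le[of "\<lambda>_. 1" \<theta> x] by (intro abs_perturbation_le P1_integral_le[OF u]) simp
  qed
qed simp

end

theorem theorem2:
  fixes M :: "'a::metric_space measure" and nu :: "'b::metric_space measure"
    and p :: "'a \<Rightarrow> real" and q :: "'a \<Rightarrow> 'a \<Rightarrow> real" and f :: "'a \<Rightarrow> 'b \<Rightarrow> real"
    and y :: 'b and eps :: real and \<theta>0 :: 'a and N :: nat
  assumes M_borel: "sets M = sets borel" and M_sf: "sigma_finite_measure M"
    and nu_borel: "sets nu = sets borel" and nu_sf: "sigma_finite_measure nu"
    and eps_pos: "eps > 0"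
    and p_meas: "p \<in> borel_measurable M" and p_nonneg: "\<forall>\<theta>. p \<theta> \<ge> 0"
    and f_meas: "(\<lambda>(\<theta>, x). f \<theta> x) \<in> borel_measurable (M \<Otimes>\<^sub>M nu)"
    and f_nonneg: "\<forall>\<theta> x. f \<theta> x \<ge> 0"
    and f_prob: "\<forall>\<theta>. prob_space (lik nu f \<theta>)"
    and q_meas: "(\<lambda>(\<theta>, t). q \<theta> t) \<in> borel_measurable (M \<Otimes>\<^sub>M M)"
    and q_nonneg: "\<forall>\<theta> t. q \<theta> t \<ge> 0"
    and q_prob: "\<forall>\<theta>. prob_space (density M (\<lambda>t. ennreal (q \<theta> t)))"
    and H_fin: "integrable M (\<lambda>\<theta>. p \<theta> * hfun nu f y eps \<theta>)"
    and H_pos: "Hconst M p nu f y eps > 0"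
    and cond1_Q: "\<forall>\<delta>>0. \<exists>r>0. \<forall>\<theta>.
                    measure (density M (\<lambda>t. ennreal (q \<theta> t))) (- ball \<theta> r) < \<delta>"
    and cond1_tail: "\<forall>r>0. measure (post M p nu f y eps) (- ball \<theta>0 r) > 0"
    and cond1_h: "((\<lambda>v. SUP \<theta>\<in>- ball \<theta>0 v. hfun nu f y eps \<theta>) \<longlongrightarrow> 0) at_top"
    and N_pos: "N \<ge> 1"
  shows "\<not> variance_bounding (ext_post N M p nu f y eps) (P1op N M p q nu f y eps)
       \<and> \<not> variance_bounding (post M p nu f y eps) (P2op N M p q nu f y eps)"
proof -
  interpret abc_posterior M nu p q f y eps \<theta>0 N
    by (rule abc_posterior.intro) (use assms in blast)+
  show ?thesis
    using P1_not_variance_bounding P2_not_variance_bounding by simp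
qed

end
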